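(* Let $\Pi$ be a Gibbs partition with parameters $(\alpha,V)$, let $n,m\ge1$, and condition on the restriction of $\Pi$ to $[n]$ being a given partition into $j$ blocks with sizes $\mathbf n=(n_1,\dots,n_j)$. Let $K_m$ be the number of new blocks generated by the integers $n+1,\dots,n+m$ and $(S_1,\dots,S_{K_m})$ the sizes of the new blocks in exchangeable random order. Then for all integers $r\ge1$, $k$, and $s_1,\dots,s_r\ge1$ with $\sum_{i=1}^r s_i\le m$ and $0\le k-r\le m-\sum_{i=1}^r s_i$, $$\mathbb{P}(S_1=s_1,\dots,S_r=s_r,K_m=k\mid\mathbf n)=\frac{m!\,\prod_{i=1}^r(1-\alpha)_{s_i-1}}{\prod_{i=1}^r s_i!\,(m-\sum_{i=1}^r s_i)!}\,\frac{(k-r)!}{k!}\,\frac{V_{n+m,j+k}}{V_{n,j}}\,S^{-1,-\alpha,-(n-j\alpha)}_{m-\sum_{i=1}^r s_i,\;k-r}.$$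
   Context: Notation: $(x)_n=x(x+1)\cdots(x+n-1)$ ($(x)_0=1$). Gibbs partition with parameters $(\alpha,V)$: $\alpha\in(-\infty,1)$ and $V=(V_{n,k})_{1\le k\le n}$ are nonnegative weights with $V_{1,1}=1$ and $V_{n,k}=(n-k\alpha)V_{n+1,k}+V_{n+1,k+1}$; $\Pi$ is the exchangeable random partition of the positive integers such that for every $n$ and every partition $\{A_1,\dots,A_k\}$ of $[n]=\{1,\dots,n\}$, the restriction $\Pi_n$ of $\Pi$ to $[n]$ satisfies $\mathbb{P}(\Pi_n=\{A_1,\dots,A_k\})=V_{n,k}\prod_{i=1}^k(1-\alpha)_{|A_i|-1}$. Conditional setting: it is assumed $V_{n,j}>0$. Given $\Pi_n$ (with $j$ blocks of sizes $n_1,\dots,n_j$), a block of $\Pi_{n+m}$ is old if it meets $[n]$, new otherwise. Exchangeable random order: given the new blocks, they are listed in uniformly random order (independent of everything else). The conditional probability that $\Pi_{n+m}$ equals a specified partition extending $\Pi_n$, in which the old blocks gain $m_1,\dots,m_j\ge0$ elements and there are $k$ new blocks of sizes $s_1,\dots,s_k\ge1$, is $\frac{V_{n+m,j+k}}{V_{n,j}}\prod_{i=1}^j(n_i-\alpha)_{m_i}\prod_{i=1}^k(1-\alpha)_{s_i-1}$. Generalized central Stirling numbers: $S^{-1,-\alpha}_{n,k}=\frac{n!}{k!}\sum_{(n_1,\dots,n_k)}\prod_{j=1}^k\frac{(1-\alpha)_{n_j-1}}{n_j!}$, the sum being over compositions of $n$ into $k$ positive parts ($S_{0,0}^{-1,-\alpha}=1$,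 $S_{n,0}^{-1,-\alpha}=0$ for $n\ge1$, $S_{n,k}^{-1,-\alpha}=0$ for $k>n$). Generalized non-central Stirling numbers: $S^{-1,-\alpha,\gamma}_{n,k}=\sum_{s=k}^n\binom ns S^{-1,-\alpha}_{s,k}(-\gamma)_{n-s}$. *)

theory Defs
  imports "HOL-Probability.Probability" "HOL-Combinatorics.Multiset_Permutations"
begin

definition restr :: "nat set set \<Rightarrow> nat \<Rightarrow> nat set set" where
  "restr P n = (\<inter>) {1..n} ` P - {{}}"

lemma partition_on_restr:
  assumes "partition_on A P" and "{1..n} \<subseteq> A"
  shows "partition_on {1..n} (restr P n)"
proof -
  have "{1..n} \<inter> A = {1..n}" using assms(2) by blast
  then show ?thesis
    using partition_on_restrict[OF assms(1), of "{1..n}"] by (simp add: restr_def)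
qed

definition gibbs_weights :: "real \<Rightarrow> (nat \<Rightarrow> nat \<Rightarrow> real) \<Rightarrow> bool" where
  "gibbs_weights \<alpha> V \<longleftrightarrow>
     V 1 1 = 1 \<and>
     (\<forall>n k. 1 \<le> k \<and> k \<le> n \<longrightarrow>
        V n k \<ge> 0 \<and> V n k = (real n - real k * \<alpha>) * V (Suc n) k + V (Suc n) (Suc k))"

text \<open>A random partition \<open>X\<close> of the positive integers is observed through its
  restrictions to the sets \<open>{1..n}\<close>. Each restriction takes finitely many values, so
  measurability into the full power set says that all events concerning it are measurable.
  Exchangeability is not a separate axiom: the law in \<open>gibbs_law\<close> depends on the finite
  partition \<open>P\<close> only through its multiset of block sizes.\<close>

locale gibbs_partition = prob_space M
  for M :: "'a measure" and \<alpha> :: real and V :: "nat \<Rightarrow> nat \<Rightarrow> real"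
    and X :: "'a \<Rightarrow> nat set set" +
  assumes alpha_less_1: "\<alpha> < 1"
    and weights: "gibbs_weights \<alpha> V"
    and partition: "\<And>\<omega>. \<omega> \<in> space M \<Longrightarrow> partition_on {1..} (X \<omega>)"
    and measurable_restr: "\<And>n. (\<lambda>\<omega>. restr (X \<omega>) n) \<in> M \<rightarrow>\<^sub>M count_space UNIV"
    and gibbs_law: "\<And>n P. 1 \<le> n \<Longrightarrow> partition_on {1..n} P \<Longrightarrow>
      \<P>(\<omega> in M. restr (X \<omega>) n = P) = V n (card P) * (\<Prod>A\<in>P. pochhammer (1 - \<alpha>) (card A - 1))"

definition new_blocks :: "nat \<Rightarrow> nat \<Rightarrow> nat set set \<Rightarrow> nat set set" where
  "new_blocks n m P = {B \<in> restr P (n + m). B \<inter> {1..n} = {}}"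

text \<open>\<open>L\<close> lists the new blocks in exchangeable random order: conditionally on the whole
  random partition, all orderings of its new blocks are equally likely. Since the events
  \<open>restr (X \<omega>) N = P\<close> with \<open>N \<ge> n + m\<close> form, together with the empty set, an
  intersection-stable generator of the sigma-algebra of \<open>X\<close>, it is enough to condition on
  these. The product form of the identity also covers events of probability zero.\<close>

definition exchangeable_order ::
  "'a measure \<Rightarrow> ('a \<Rightarrow> nat set set) \<Rightarrow> nat \<Rightarrow> nat \<Rightarrow> ('a \<Rightarrow> nat set list) \<Rightarrow> bool" where
  "exchangeable_order M X n m L \<longleftrightarrow>
     L \<in> M \<rightarrow>\<^sub>M count_space UNIV \<and>
     (\<forall>\<omega>\<in>space M. L \<omega> \<in> permutations_of_set (new_blocks n m (X \<omega>))) \<and>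
     (\<forall>N P l. n + m \<le> N \<and> partition_on {1..N} P \<and> l \<in> permutations_of_set (new_blocks n m P) \<longrightarrow>
        \<P>(\<omega> in M. restr (X \<omega>) N = P \<and> L \<omega> = l) =
        \<P>(\<omega> in M. restr (X \<omega>) N = P) / fact (card (new_blocks n m P)))"

definition num_new :: "('a \<Rightarrow> nat set set) \<Rightarrow> nat \<Rightarrow> nat \<Rightarrow> 'a \<Rightarrow> nat" where
  "num_new X n m \<omega> = card (new_blocks n m (X \<omega>))"

text \<open>The size \<open>S\<^sub>i\<close> is indexed from 1 and is meaningful for \<open>1 \<le> i \<le> num_new X n m \<omega>\<close>,
  the latter being the length of \<open>L \<omega>\<close>.\<close>

definition new_size :: "('a \<Rightarrow> nat set list) \<Rightarrow> nat \<Rightarrow> 'a \<Rightarrow> nat" where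
  "new_size L i \<omega> = card (L \<omega> ! (i - 1))"

definition compositions :: "nat \<Rightarrow> nat \<Rightarrow> nat list set" where
  "compositions n k = {ns. length ns = k \<and> sum_list ns = n \<and> (\<forall>x\<in>set ns. 1 \<le> x)}"

text \<open>\<open>central_stirling \<alpha> n k\<close> is the generalized central Stirling number
  with upper index \<open>(-1, -\<alpha>)\<close>, and \<open>noncentral_stirling \<alpha> \<gamma> n k\<close> the generalized
  non-central one with upper index \<open>(-1, -\<alpha>, \<gamma>)\<close>.\<close>

definition central_stirling :: "real \<Rightarrow> nat \<Rightarrow> nat \<Rightarrow> real" where
  "central_stirling \<alpha> n k =
     fact n / fact k *
     (\<Sum>ns\<in>compositions n k. \<Prod>x\<leftarrow>ns. pochhammer (1 - \<alpha>) (x - 1) / fact x)"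

definition noncentral_stirling :: "real \<Rightarrow> real \<Rightarrow> nat \<Rightarrow> nat \<Rightarrow> real" where
  "noncentral_stirling \<alpha> \<gamma> n k =
     (\<Sum>s=k..n. real (n choose s) * central_stirling \<alpha> s k * pochhammer (-\<gamma>) (n - s))"

lemma finite_compositions: "finite (compositions n k)"
proof (rule finite_subset)
  show "compositions n k \<subseteq> {ns. set ns \<subseteq> {..n} \<and> length ns = k}"
    by (auto simp: compositions_def dest: member_le_sum_list)
qed (rule finite_lists_length_eq, simp)

lemma central_stirling_0_0: "central_stirling \<alpha> 0 0 = 1"
proof -
  have "compositions 0 0 = {[]}" by (auto simp: compositions_def)
  then show ?thesis by (simp add: central_stirling_def)
qed

lemma central_stirling_n_0: "1 \<le> n \<Longrightarrow> central_stirling \<alpha> n 0 = 0"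
proof -
  assume "1 \<le> n"
  then have "compositions n 0 = {}" by (auto simp: compositions_def)
  then show ?thesis by (simp add: central_stirling_def)
qed

lemma central_stirling_eq_0: "n < k \<Longrightarrow> central_stirling \<alpha> n k = 0"
proof -
  assume "n < k"
  have "length ns \<le> sum_list ns" if "\<forall>x\<in>set ns. 1 \<le> x" for ns :: "nat list"
    using that by (induction ns) auto
  with \<open>n < k\<close> have "compositions n k = {}" by (fastforce simp: compositions_def)
  then show ?thesis by (simp add: central_stirling_def)
qed

end

theory Submission
  imports Defs
begin

text \<open>A partition of \<open>{1..n + m}\<close> extending \<open>\<pi>\<close>, together with an ordering of its new blocks,
  amounts to a list of disjoint nonempty subsets of \<open>{n + 1..n + m}\<close> and a map sending each
  remaining element to the block of \<open>\<pi>\<close> which it joins. The lists with prescribed sizes are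
  counted by a multinomial coefficient; the sum of the Gibbs weights over the maps factors as a
  rising factorial of \<open>n - j * \<alpha>\<close> by the Chu-Vandermonde identity. This gives the joint law
  of all new block sizes, and summing out the sizes after the first \<open>r\<close> produces the
  noncentral Stirling number.\<close>

section \<open>Chu-Vandermonde identity as a sum over maps\<close>

text \<open>This is the normalisation of a Polya urn. A new element sent to \<open>y\<close>
  multiplies the weight of \<open>f\<close> by \<open>a y\<close> plus the size of the fibre over
  \<open>y\<close>. Summed over \<open>y\<close>, these factors give the total of \<open>a\<close>
  plus \<open>card R\<close>, which does not depend on \<open>f\<close>, so each insertion
  contributes the next factor of the rising factorial.\<close>

lemma sum_PiE_prod_pochhammer:
  fixes a :: "'b \<Rightarrow> real"
  assumes "finite I" "finite R"
  shows "(\<Sum>f\<in>R \<rightarrow>\<^sub>E I. \<Prod>i\<in>I. pochhammer (a i) (card {x\<in>R. f x = i})) =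
    pochhammer (\<Sum>i\<in>I. a i) (card R)"
  using assms(2)
proof (induction R)
  case empty
  then show ?case by simp
next
  case (insert x R)
  let ?c = "\<lambda>f i. card {x\<in>R. f x = i}"
  let ?p = "\<lambda>f. \<Prod>i\<in>I. pochhammer (a i) (?c f i)"
  have prod: "(\<Prod>i\<in>I. pochhammer (a i) (card {z\<in>insert x R. (f(x:=y)) z = i})) =
      ?p f * (a y + real (?c f y))" if "y \<in> I" for f y
  proof -
    have *: "pochhammer (a i) (card {z\<in>insert x R. (f(x:=y)) z = i}) =
        pochhammer (a i) (?c f i) * (if i = y then a y + real (?c f y) else 1)" for i
    proof (cases "i = y")
      case True
      have "{z\<in>insert x R. (f(x:=y)) z = i} = insert x {z\<in>R. f z = y}"
        using True insert.hyps by auto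
      then show ?thesis using True insert.hyps by (simp add: pochhammer_Suc)
    next
      case False
      have "{z\<in>insert x R. (f(x:=y)) z = i} = {z\<in>R. f z = i}"
        using False insert.hyps by auto
      then show ?thesis using False by simp
    qed
    have "(\<Prod>i\<in>I. if i = y then a y + real (?c f y) else 1) = a y + real (?c f y)"
      using that assms(1) by simp
    then show ?thesis unfolding * prod.distrib by simp
  qed
  \<comment> \<open>The fibres of \<open>f\<close> partition \<open>R\<close>.\<close>
  have total: "(\<Sum>y\<in>I. real (?c f y)) = real (card R)" if "f \<in> R \<rightarrow>\<^sub>E I" for f
  proof -
    have "(\<Sum>y\<in>I. \<Sum>x | x \<in> R \<and> f x = y. 1) = (\<Sum>x\<in>R. 1::real)"
      using that assms(1) insert.hyps by (intro sum.group) auto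
    then show ?thesis by simp
  qed
  have inj: "inj_on (\<lambda>(y, g). g(x := y)) (I \<times> (R \<rightarrow>\<^sub>E I))"
    using insert.hyps by (intro inj_combinator)
  have "(\<Sum>f\<in>insert x R \<rightarrow>\<^sub>E I. \<Prod>i\<in>I. pochhammer (a i) (card {z\<in>insert x R. f z = i})) =
      (\<Sum>(y, f)\<in>I \<times> (R \<rightarrow>\<^sub>E I). ?p f * (a y + real (?c f y)))"
    unfolding PiE_insert_eq sum.reindex[OF inj] o_def
  proof (rule sum.cong[OF refl])
    fix p assume "p \<in> I \<times> (R \<rightarrow>\<^sub>E I)"
    then obtain y f where p: "p = (y, f)" "y \<in> I" by auto
    then show "(\<Prod>i\<in>I. pochhammer (a i) (card {z\<in>insert x R. (case p of (y, g) \<Rightarrow> g(x := y)) z = i})) =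
        (case p of (y, f) \<Rightarrow> ?p f * (a y + real (?c f y)))"
      using prod by (simp only: prod.case)
  qed
  \<comment> \<open>The image of the new element is summed innermost, with the map on
    \<open>R\<close> held fixed.\<close>
  also have "\<dots> = (\<Sum>f\<in>R \<rightarrow>\<^sub>E I. \<Sum>y\<in>I. ?p f * (a y + real (?c f y)))"
    by (subst sum.swap) (simp only: sum.cartesian_product)
  also have "\<dots> = (\<Sum>f\<in>R \<rightarrow>\<^sub>E I. ?p f * ((\<Sum>i\<in>I. a i) + real (card R)))"
    by (intro sum.cong refl) (simp add: sum_distrib_left[symmetric] sum.distrib total)
  also have "\<dots> = pochhammer (\<Sum>i\<in>I. a i) (card (insert x R))"
    using insert by (simp add: sum_distrib_right[symmetric] pochhammer_Suc)
  finally show ?case .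
qed

section \<open>Extensions of a partition without new blocks\<close>

text \<open>Unlike in \<open>restr\<close>, the empty set is not removed from the image: when \<open>{} \<notin> \<pi>\<close>, this
  forces every block of \<open>Q\<close> to meet \<open>\<Union>\<pi>\<close>, so that no new blocks arise.\<close>

definition extensions :: "'b set set \<Rightarrow> 'b set \<Rightarrow> 'b set set set" where
  "extensions \<pi> R = {Q. partition_on (\<Union>\<pi> \<union> R) Q \<and> (\<inter>) (\<Union>\<pi>) ` Q = \<pi>}"

definition enlarge :: "'b set \<Rightarrow> ('b \<Rightarrow> 'b set) \<Rightarrow> 'b set \<Rightarrow> 'b set" where
  "enlarge R f A = A \<union> {x\<in>R. f x = A}"

context
  fixes \<pi> :: "'b set set" and R :: "'b set"
  assumes disj: "disjoint \<pi>" and nonempty: "{} \<notin> \<pi>" and R: "\<Union>\<pi> \<inter> R = {}"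
begin

text \<open>Since \<open>R\<close> avoids the ground set of \<pi>, taking the trace on that set
  undoes \<open>enlarge\<close>. This left inverse drives the injectivity arguments below.\<close>

lemma Union_Int_enlarge:
  assumes "A \<in> \<pi>"
  shows "\<Union>\<pi> \<inter> enlarge R f A = A"
  using assms R by (auto simp: enlarge_def)

lemma inj_on_enlarge: "inj_on (enlarge R f) \<pi>"
  by (rule inj_on_inverseI[of _ "(\<inter>) (\<Union>\<pi>)"]) (rule Union_Int_enlarge)

text \<open>An extension is determined by which old block each element of \<open>R\<close> joins.
  Conversely, every block of an extension has a nonempty trace, and this trace names the old block
  it enlarges.\<close>

lemma bij_betw_extensions:
  "bij_betw (\<lambda>f. enlarge R f ` \<pi>) (R \<rightarrow>\<^sub>E \<pi>) (extensions \<pi> R)"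
  unfolding bij_betw_def
proof
  show "inj_on (\<lambda>f. enlarge R f ` \<pi>) (R \<rightarrow>\<^sub>E \<pi>)"
  proof (rule inj_onI)
    fix f g assume f: "f \<in> R \<rightarrow>\<^sub>E \<pi>" and g: "g \<in> R \<rightarrow>\<^sub>E \<pi>"
      and eq: "enlarge R f ` \<pi> = enlarge R g ` \<pi>"
    show "f = g"
    proof (rule PiE_ext[OF f g])
      fix x assume x: "x \<in> R"
      then have fx: "f x \<in> \<pi>" using f by auto
      then have "enlarge R f (f x) \<in> enlarge R g ` \<pi>" using eq by blast
      then obtain A where A: "A \<in> \<pi>" "enlarge R f (f x) = enlarge R g A" by auto
      then have "f x = A" using Union_Int_enlarge fx by metis
      moreover have "x \<in> enlarge R g A" using A(2) x by (auto simp: enlarge_def)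
      moreover have "x \<notin> A" using A(1) R x by auto
      ultimately show "f x = g x" by (auto simp: enlarge_def)
    qed
  qed
  show "(\<lambda>f. enlarge R f ` \<pi>) ` (R \<rightarrow>\<^sub>E \<pi>) = extensions \<pi> R"
  proof (intro subset_antisym subsetI)
    fix Q assume "Q \<in> (\<lambda>f. enlarge R f ` \<pi>) ` (R \<rightarrow>\<^sub>E \<pi>)"
    then obtain f where f: "f \<in> R \<rightarrow>\<^sub>E \<pi>" and Q: "Q = enlarge R f ` \<pi>" by auto
    have "\<Union>Q = \<Union>\<pi> \<union> R" using f by (fastforce simp: Q enlarge_def)
    moreover have "disjoint Q"
    proof (rule disjointI)
      fix B C assume "B \<in> Q" "C \<in> Q" "B \<noteq> C"
      then obtain A A' where A: "A \<in> \<pi>" "A' \<in> \<pi>" "B = enlarge R f A" "C = enlarge R f A'" "A \<noteq> A'"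
        by (auto simp: Q)
      then have "A \<inter> A' = {}" using disj by (auto simp: disjoint_def)
      then show "B \<inter> C = {}" using A R by (auto simp: enlarge_def)
    qed
    moreover have "{} \<notin> Q" using nonempty by (auto simp: Q enlarge_def)
    moreover have "(\<inter>) (\<Union>\<pi>) ` Q = \<pi>"
      by (simp add: Q image_image Union_Int_enlarge)
    ultimately show "Q \<in> extensions \<pi> R" by (simp add: extensions_def partition_on_def)
  next
    fix Q assume "Q \<in> extensions \<pi> R"
    then have UQ: "\<Union>Q = \<Union>\<pi> \<union> R" and dQ: "disjoint Q" and rQ: "(\<inter>) (\<Union>\<pi>) ` Q = \<pi>"
      by (auto simp: extensions_def partition_on_def)
    have "\<forall>x\<in>R. \<exists>B. B \<in> Q \<and> x \<in> B" using UQ by blast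
    then obtain b where b: "b x \<in> Q" "x \<in> b x" if "x \<in> R" for x by metis
    \<comment> \<open>The block joined by \<open>x\<close> is read off as the trace of the block
      \<open>b x\<close> of \<open>Q\<close> containing \<open>x\<close>.\<close>
    define f where "f = restrict (\<lambda>x. \<Union>\<pi> \<inter> b x) R"
    have enl: "enlarge R f (\<Union>\<pi> \<inter> B) = B" if B: "B \<in> Q" for B
    proof -
      \<comment> \<open>Distinct blocks of \<open>Q\<close> have distinct traces: a common trace
        would be nonempty, so the two blocks would meet.\<close>
      have "\<Union>\<pi> \<inter> b x = \<Union>\<pi> \<inter> B \<longleftrightarrow> x \<in> B" if x: "x \<in> R" for x
      proof
        assume eq: "\<Union>\<pi> \<inter> b x = \<Union>\<pi> \<inter> B"
        have "\<Union>\<pi> \<inter> B \<in> \<pi>" using rQ B by blast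
        then have "\<Union>\<pi> \<inter> B \<noteq> {}" using nonempty by metis
        then have "b x \<inter> B \<noteq> {}" using eq by blast
        then have "b x = B" using dQ b(1)[OF x] B by (auto simp: disjoint_def)
        then show "x \<in> B" using b(2)[OF x] by simp
      next
        assume "x \<in> B"
        then have "b x = B" using dQ b[OF x] B by (auto simp: disjoint_def)
        then show "\<Union>\<pi> \<inter> b x = \<Union>\<pi> \<inter> B" by simp
      qed
      then have "enlarge R f (\<Union>\<pi> \<inter> B) = \<Union>\<pi> \<inter> B \<union> {x\<in>R. x \<in> B}"
        by (auto simp: enlarge_def f_def)
      also have "\<dots> = B" using B UQ by blast
      finally show ?thesis .
    qed
    have "enlarge R f ` \<pi> = enlarge R f ` (\<inter>) (\<Union>\<pi>) ` Q" using rQ by simp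
    also have "\<dots> = Q" by (simp add: image_image enl)
    finally have "enlarge R f ` \<pi> = Q" .
    moreover have "f \<in> R \<rightarrow>\<^sub>E \<pi>" using b(1) rQ by (auto simp: f_def)
    ultimately show "Q \<in> (\<lambda>f. enlarge R f ` \<pi>) ` (R \<rightarrow>\<^sub>E \<pi>)" by blast
  qed
qed

text \<open>Because \<open>enlarge\<close> is injective on blocks, the second index of
  \<open>V\<close> will not depend on how the old blocks grow.\<close>

lemma card_extensions:
  assumes "Q \<in> extensions \<pi> R"
  shows "card Q = card \<pi>"
proof -
  obtain f where "Q = enlarge R f ` \<pi>"
    using assms unfolding bij_betw_imp_surj_on[OF bij_betw_extensions, symmetric] by (elim imageE)
  then show ?thesis using card_image[OF inj_on_enlarge] by simp
qed

text \<open>When \<open>A\<close> gains \<open>c\<close> elements, its Gibbs factor splits into the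
  old factor and a rising factorial of length \<open>c\<close> starting at \<open>card A\<close> -
  \<alpha>. The old factors come out of the sum, and the rest is the urn identity with initial
  weights \<open>card A\<close> - \<alpha>, which add up to the base on the right.\<close>

lemma sum_extensions_prod_pochhammer:
  assumes "finite (\<Union>\<pi>)" "finite R"
  shows "(\<Sum>Q\<in>extensions \<pi> R. \<Prod>B\<in>Q. pochhammer (1 - \<alpha>) (card B - 1)) =
    (\<Prod>A\<in>\<pi>. pochhammer (1 - \<alpha>) (card A - 1)) *
      pochhammer (real (card (\<Union>\<pi>)) - real (card \<pi>) * \<alpha>) (card R)"
proof -
  have fin: "finite \<pi>" "\<And>A. A \<in> \<pi> \<Longrightarrow> finite A"
    using assms(1) finite_UnionD by (blast, meson Union_upper finite_subset)
  have card_pos: "0 < card A" if "A \<in> \<pi>" for A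
    using that fin nonempty by (metis card_gt_0_iff)
  have "(\<Sum>A\<in>\<pi>. real (card A) - \<alpha>) = real (card (\<Union>\<pi>)) - real (card \<pi>) * \<alpha>"
    using card_Union_disjoint[of \<pi>] disj fin by (simp add: sum_subtractf)
  then have poch: "(\<Sum>f\<in>R \<rightarrow>\<^sub>E \<pi>. \<Prod>A\<in>\<pi>. pochhammer (real (card A) - \<alpha>) (card {x\<in>R. f x = A})) =
      pochhammer (real (card (\<Union>\<pi>)) - real (card \<pi>) * \<alpha>) (card R)"
    using sum_PiE_prod_pochhammer[of \<pi> R "\<lambda>A. real (card A) - \<alpha>"] fin assms by simp
  have block: "pochhammer (1 - \<alpha>) (card (enlarge R f A) - 1) =
      pochhammer (1 - \<alpha>) (card A - 1) * pochhammer (real (card A) - \<alpha>) (card {x\<in>R. f x = A})"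
    if "A \<in> \<pi>" for f A
  proof -
    have "card (enlarge R f A) = card A + card {x\<in>R. f x = A}"
      unfolding enlarge_def using that R fin assms by (intro card_Un_disjoint) auto
    \<comment> \<open>Truncated subtraction is harmless here because \<open>A\<close> is
      nonempty.\<close>
    then have "card (enlarge R f A) - 1 = (card A - 1) + card {x\<in>R. f x = A}"
      using card_pos[OF that] by simp
    moreover have "1 - \<alpha> + real (card A - 1) = real (card A) - \<alpha>"
      using card_pos[OF that] by (simp add: of_nat_diff)
    ultimately show ?thesis by (simp only: pochhammer_product')
  qed
  have "(\<Sum>Q\<in>extensions \<pi> R. \<Prod>B\<in>Q. pochhammer (1 - \<alpha>) (card B - 1)) =
      (\<Sum>f\<in>R \<rightarrow>\<^sub>E \<pi>. \<Prod>B\<in>enlarge R f ` \<pi>. pochhammer (1 - \<alpha>) (card B - 1))"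
    by (rule sum.reindex_bij_betw[OF bij_betw_extensions, symmetric])
  also have "\<dots> = (\<Sum>f\<in>R \<rightarrow>\<^sub>E \<pi>. (\<Prod>A\<in>\<pi>. pochhammer (1 - \<alpha>) (card A - 1)) *
      (\<Prod>A\<in>\<pi>. pochhammer (real (card A) - \<alpha>) (card {x\<in>R. f x = A})))"
    by (intro sum.cong refl) (simp add: prod.reindex[OF inj_on_enlarge] block prod.distrib[symmetric] del: One_nat_def)
  also have "\<dots> = (\<Prod>A\<in>\<pi>. pochhammer (1 - \<alpha>) (card A - 1)) *
      pochhammer (real (card (\<Union>\<pi>)) - real (card \<pi>) * \<alpha>) (card R)"
    by (simp add: sum_distrib_left[symmetric] poch)
  finally show ?thesis .
qed

end

section \<open>Counting lists of disjoint sets of given sizes\<close>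

text \<open>Disjointness is imposed along the list rather than on its set of entries, so that it
  unfolds with \<open>Cons\<close>; the entries need not cover \<open>U\<close>.\<close>

definition block_lists :: "'b set \<Rightarrow> nat list \<Rightarrow> 'b set list set" where
  "block_lists U ns = {l. map card l = ns \<and> sorted_wrt disjnt l \<and> \<Union>(set l) \<subseteq> U}"

lemma block_lists_Nil: "block_lists U [] = {[]}"
  by (auto simp: block_lists_def)

lemma block_lists_Cons:
  "block_lists U (a # ns) =
    (\<lambda>(B, l). B # l) ` (SIGMA B:{B. B \<subseteq> U \<and> card B = a}. block_lists (U - B) ns)"
  (is "?L = ?R")
proof (intro subset_antisym subsetI)
  fix l assume "l \<in> ?L"
  then obtain B l' where "l = B # l'" by (cases l) (auto simp: block_lists_def)
  then have "B \<subseteq> U" "card B = a" "l' \<in> block_lists (U - B) ns"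
    using \<open>l \<in> ?L\<close> by (auto simp: block_lists_def disjnt_def)
  with \<open>l = B # l'\<close> show "l \<in> ?R" by force
next
  fix l assume "l \<in> ?R"
  then obtain B l' where "l = B # l'" "B \<subseteq> U" "card B = a" "l' \<in> block_lists (U - B) ns"
    by auto
  then show "l \<in> ?L" by (auto simp: block_lists_def disjnt_def)
qed

lemma finite_block_lists: "finite U \<Longrightarrow> finite (block_lists U ns)"
  by (induction ns arbitrary: U) (simp_all add: block_lists_Nil block_lists_Cons)

text \<open>The first set can be chosen in \<open>card U choose a\<close> ways and the others lie in
  its complement, so the binomial coefficients telescope to a multinomial coefficient whose last
  class is the uncovered part of \<open>U\<close>.\<close>

lemma card_block_lists:
  assumes "finite U" "sum_list ns \<le> card U"
  shows "real (card (block_lists U ns)) =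
    fact (card U) / ((\<Prod>x\<leftarrow>ns. fact x) * fact (card U - sum_list ns))"
  using assms
proof (induction ns arbitrary: U)
  case Nil
  then show ?case by (simp add: block_lists_Nil)
next
  case (Cons a ns)
  have inj: "inj_on (\<lambda>(B, l). B # l) (SIGMA B:{B. B \<subseteq> U \<and> card B = a}. block_lists (U - B) ns)"
    by (auto simp: inj_on_def)
  have "card (block_lists U (a # ns)) = (\<Sum>B | B \<subseteq> U \<and> card B = a. card (block_lists (U - B) ns))"
    unfolding block_lists_Cons card_image[OF inj]
    using Cons.prems by (subst card_SigmaI) (auto simp: finite_block_lists)
  also have "real \<dots> = (\<Sum>B | B \<subseteq> U \<and> card B = a.
      fact (card U - a) / ((\<Prod>x\<leftarrow>ns. fact x) * fact (card U - sum_list (a # ns))))"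
    unfolding of_nat_sum
  proof (intro sum.cong refl)
    fix B assume "B \<in> {B. B \<subseteq> U \<and> card B = a}"
    then have "card (U - B) = card U - a"
      using Cons.prems finite_subset[of B U] by (simp add: card_Diff_subset)
    then show "real (card (block_lists (U - B) ns)) =
        fact (card U - a) / ((\<Prod>x\<leftarrow>ns. fact x) * fact (card U - sum_list (a # ns)))"
      using Cons by simp
  qed
  also have "\<dots> = real (card U choose a) *
      (fact (card U - a) / ((\<Prod>x\<leftarrow>ns. fact x) * fact (card U - sum_list (a # ns))))"
    using n_subsets[of U a] Cons.prems by simp
  also have "\<dots> = fact (card U) / ((\<Prod>x\<leftarrow>a # ns. fact x) * fact (card U - sum_list (a # ns)))"
    using Cons.prems by (simp add: binomial_fact)
  finally show ?case .
qed

section \<open>Splitting a partition into old and new blocks\<close>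

lemma finite_extensions:
  assumes "finite (\<Union>\<pi>)" "finite R"
  shows "finite (extensions \<pi> R)"
  by (rule finite_subset[of _ "Pow (Pow (\<Union>\<pi> \<union> R))"])
    (use assms in \<open>auto simp: extensions_def partition_on_def\<close>)

text \<open>A nonempty set is not disjoint from itself, so disjointness along the list also excludes
  repetitions. This links \<open>block_lists\<close> with
  \<open>permutations_of_set\<close>.\<close>

lemma sorted_wrt_disjnt_iff:
  assumes "{} \<notin> set l"
  shows "sorted_wrt disjnt l \<longleftrightarrow> distinct l \<and> disjoint (set l)"
  using assms
proof (induction l)
  case (Cons B l)
  then have "B \<in> set l \<Longrightarrow> \<not> disjnt B B" by (auto simp: disjnt_def)
  with Cons show ?case by (auto simp: pairwise_insert disjnt_sym)
qed (simp add: pairwise_def)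

lemma partition_on_Un:
  assumes "partition_on A P" "partition_on B Q" "A \<inter> B = {}"
  shows "partition_on (A \<union> B) (P \<union> Q)"
  using assms by (auto simp: partition_on_def intro: disjoint_union)

lemma block_lists_partition:
  assumes "\<And>x. x \<in> set ns \<Longrightarrow> 1 \<le> x" "l \<in> block_lists U ns"
  shows "distinct l" "partition_on (\<Union>(set l)) (set l)"
proof -
  have "{} \<notin> set l"
  proof
    assume "{} \<in> set l"
    then have "card {} \<in> set ns" using assms(2) by (force simp: block_lists_def)
    then show False using assms(1) by force
  qed
  then show "distinct l" "partition_on (\<Union>(set l)) (set l)"
    using assms(2) sorted_wrt_disjnt_iff[of l] by (auto simp: block_lists_def partition_on_def)
qed

lemma restr_self: "partition_on {1..N} P \<Longrightarrow> restr P N = P"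
proof -
  assume P: "partition_on {1..N} P"
  then have "{1..N} \<inter> B = B" if "B \<in> P" for B using that by (auto simp: partition_on_def)
  then have "(\<inter>) {1..N} ` P = P" by simp
  then show ?thesis using P by (simp add: restr_def partition_on_def)
qed

lemma restr_restr: "n \<le> N \<Longrightarrow> restr (restr P N) n = restr P n"
proof -
  assume "n \<le> N"
  then have eq: "{1..n} \<inter> ({1..N} \<inter> B) = {1..n} \<inter> B" for B by auto
  have "restr (restr P N) n = (\<lambda>B. {1..n} \<inter> ({1..N} \<inter> B)) ` P - {{}}"
    by (auto simp: restr_def image_iff)
  then show ?thesis by (simp only: eq restr_def)
qed

lemma new_blocks_restr: "new_blocks n m (restr P (n + m)) = new_blocks n m P"
  by (simp add: new_blocks_def restr_restr)

lemma new_blocks_eq: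
  assumes "partition_on {1..n + m} P"
  shows "new_blocks n m P = {B \<in> P. B \<inter> {1..n} = {}}"
  unfolding new_blocks_def restr_self[OF assms] ..

text \<open>Old blocks meet \<open>{1..n}\<close> and new ones do not, so the union of
  \<open>Q\<close> and \<open>set l\<close> is disjoint and removing \<open>set l\<close> recovers
  \<open>Q\<close>. Summation over ordered partitions thus becomes a double sum, over
  \<open>l\<close> and then over \<open>Q\<close>.\<close>

lemma bij_betw_old_new_blocks:
  fixes n m :: nat
  assumes \<pi>: "partition_on {1..n} \<pi>" and ns: "\<And>x. x \<in> set ns \<Longrightarrow> 1 \<le> x"
  defines "U \<equiv> {n + 1..n + m}"
  shows "bij_betw (\<lambda>(l, Q). (Q \<union> set l, l))
    (SIGMA l:block_lists U ns. extensions \<pi> (U - \<Union>(set l)))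
    {(P, l). partition_on {1..n + m} P \<and> restr P n = \<pi> \<and>
      l \<in> permutations_of_set (new_blocks n m P) \<and> map card l = ns}"
    (is "bij_betw ?f ?A ?B")
proof (rule bij_betw_byWitness[where f' = "\<lambda>(P, l). (l, P - set l)"])
  have U\<pi>: "\<Union>\<pi> = {1..n}" and e: "{} \<notin> \<pi>" using \<pi> by (auto simp: partition_on_def)
  have U: "{1..n} \<inter> U = {}" "{1..n} \<union> U = {1..n + m}" by (auto simp: U_def)
  have old: "B \<inter> {1..n} \<noteq> {}" if "Q \<in> extensions \<pi> R" "B \<in> Q" for Q R B
    using that e by (auto simp: extensions_def U\<pi>)
  have new: "B \<inter> {1..n} = {}" if "l \<in> block_lists U ns" "B \<in> set l" for l B
    using that U(1) by (auto simp: block_lists_def)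
  show "\<forall>a\<in>?A. (case ?f a of (P, l) \<Rightarrow> (l, P - set l)) = a"
    using old new by fastforce
  show "\<forall>a\<in>?B. ?f (case a of (P, l) \<Rightarrow> (l, P - set l)) = a"
    by (auto simp: new_blocks_eq permutations_of_set_def)
  show "?f ` ?A \<subseteq> ?B"
  proof clarify
    fix l Q assume l: "l \<in> block_lists U ns" and Q: "Q \<in> extensions \<pi> (U - \<Union>(set l))"
    note part = block_lists_partition[OF ns l]
    have sub: "\<Union>(set l) \<subseteq> U" using l by (simp add: block_lists_def)
    have "partition_on ({1..n} \<union> (U - \<Union>(set l))) Q" using Q by (simp add: extensions_def U\<pi>)
    then have "partition_on (({1..n} \<union> (U - \<Union>(set l))) \<union> \<Union>(set l)) (Q \<union> set l)"
      using part(2) U(1) sub by (intro partition_on_Un) auto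
    moreover have "({1..n} \<union> (U - \<Union>(set l))) \<union> \<Union>(set l) = {1..n + m}"
      using U sub by blast
    ultimately have P: "partition_on {1..n + m} (Q \<union> set l)" by simp
    have "(\<inter>) {1..n} ` Q = \<pi>" using Q by (simp add: extensions_def U\<pi>)
    \<comment> \<open>New blocks contribute only the empty trace, which \<open>restr\<close>
      discards.\<close>
    moreover have "(\<inter>) {1..n} ` set l \<subseteq> {{}}" using new[OF l] by blast
    ultimately have "restr (Q \<union> set l) n = \<pi>" using e by (auto simp: restr_def image_Un)
    moreover have "new_blocks n m (Q \<union> set l) = set l"
      using old[OF Q] new[OF l] by (auto simp: new_blocks_eq[OF P])
    moreover have "map card l = ns" using l by (simp add: block_lists_def)
    ultimately show "partition_on {1..n + m} (Q \<union> set l) \<and> restr (Q \<union> set l) n = \<pi> \<and>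
        l \<in> permutations_of_set (new_blocks n m (Q \<union> set l)) \<and> map card l = ns"
      using P part(1) by (simp add: permutations_of_set_def)
  qed
  show "(\<lambda>(P, l). (l, P - set l)) ` ?B \<subseteq> ?A"
  proof clarify
    fix P l assume P: "partition_on {1..n + m} P" and "\<pi> = restr P n"
      and l: "l \<in> permutations_of_set (new_blocks n m P)" and ns: "ns = map card l"
    then have r: "restr P n = \<pi>" by simp
    have setl: "set l = {B \<in> P. B \<inter> {1..n} = {}}" and "distinct l"
      using l by (auto simp: permutations_of_set_def new_blocks_eq[OF P])
    have UP: "\<Union>P = {1..n} \<union> U" and dP: "disjoint P" and eP: "{} \<notin> P"
      using P U(2) by (auto simp: partition_on_def)
    have sub: "\<Union>(set l) \<subseteq> U" using setl UP by auto
    have "disjoint (set l)" "{} \<notin> set l" using dP eP setl by (auto simp: disjoint_def)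
    then have "sorted_wrt disjnt l" using \<open>distinct l\<close> sorted_wrt_disjnt_iff by blast
    then have "l \<in> block_lists U (map card l)" using sub by (simp add: block_lists_def)
    moreover have "P - set l \<in> extensions \<pi> (U - \<Union>(set l))"
    proof -
      have "\<Union>(P - set l) = {1..n} \<union> (U - \<Union>(set l))"
      proof -
        have "\<Union>(P - set l) \<inter> \<Union>(set l) = {}"
        proof -
          have "set l \<subseteq> P" using setl by blast
          then have "B \<inter> C = {}" if "B \<in> P - set l" "C \<in> set l" for B C
            using that by (intro disjointD[OF dP]) auto
          then show ?thesis by blast
        qed
        moreover have "\<Union>(P - set l) \<union> \<Union>(set l) = {1..n} \<union> U"
          using UP setl by blast
        ultimately show ?thesis using sub U(1) by blast
      qed
      moreover have "disjoint (P - set l)" using dP by (simp add: disjoint_def)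
      moreover have "(\<inter>) {1..n} ` (P - set l) = \<pi>"
        unfolding r[symmetric] restr_def using setl by auto
      ultimately show ?thesis using eP by (simp add: extensions_def partition_on_def U\<pi>)
    qed
    ultimately show "l \<in> block_lists U (map card l) \<and> P - set l \<in> extensions (restr P n) (U - \<Union>(set l))"
      using r by simp
  qed
qed

section \<open>Joint law of all new block sizes\<close>

context gibbs_partition
begin

text \<open>The event splits into finitely many elementary events, one for each ordered partition.
  Their probabilities are summed over the old blocks for a fixed list \<open>l\<close>; the result
  depends on \<open>l\<close> only through \<open>ns\<close>, so the sum over \<open>l\<close> is a
  multiplication by the number of lists. The right side is grouped with one factor per size, ready
  for a sum over compositions.\<close>

lemma prob_new_sizes:
  assumes L: "exchangeable_order M X n m L" and n: "1 \<le> n" and \<pi>: "partition_on {1..n} \<pi>"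
    and ns: "\<And>x. x \<in> set ns \<Longrightarrow> 1 \<le> x" "sum_list ns \<le> m"
  shows "\<P>(\<omega> in M. restr (X \<omega>) n = \<pi> \<and> map card (L \<omega>) = ns) =
    (\<Prod>A\<in>\<pi>. pochhammer (1 - \<alpha>) (card A - 1)) *
    (V (n + m) (card \<pi> + length ns) / fact (length ns)) *
    (fact m * (\<Prod>x\<leftarrow>ns. pochhammer (1 - \<alpha>) (x - 1) / fact x)) *
    (pochhammer (real n - real (card \<pi>) * \<alpha>) (m - sum_list ns) / fact (m - sum_list ns))"
proof -
  define U where "U = {n + 1..n + m}"
  define T where "T = {(P, l). partition_on {1..n + m} P \<and> restr P n = \<pi> \<and>
      l \<in> permutations_of_set (new_blocks n m P) \<and> map card l = ns}"
  define w where "w = (\<lambda>B::nat set. pochhammer (1 - \<alpha>) (card B - 1))"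
  define E where "E = (\<lambda>(P, l). {\<omega> \<in> space M. restr (X \<omega>) (n + m) = P \<and> L \<omega> = l})"
  have U\<pi>: "\<Union>\<pi> = {1..n}" and d\<pi>: "disjoint \<pi>" and e\<pi>: "{} \<notin> \<pi>"
    using \<pi> by (auto simp: partition_on_def)
  have finU: "finite U" and cardU: "card U = m" by (auto simp: U_def)
  have UR: "\<Union>\<pi> \<inter> (U - A) = {}" for A unfolding U\<pi> U_def by fastforce
  have fin_ext: "finite (extensions \<pi> (U - A))" for A
    by (intro finite_extensions) (simp_all add: U\<pi> finU)
  have bij: "bij_betw (\<lambda>(l, Q). (Q \<union> set l, l))
      (SIGMA l:block_lists U ns. extensions \<pi> (U - \<Union>(set l))) T"
    unfolding T_def U_def by (intro bij_betw_old_new_blocks \<pi> ns(1))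
  have finT: "finite T"
    using bij_betw_finite[OF bij] finite_block_lists[OF finU] fin_ext by auto
  have Lm: "L \<in> M \<rightarrow>\<^sub>M count_space UNIV"
    and Lp: "\<And>\<omega>. \<omega> \<in> space M \<Longrightarrow> L \<omega> \<in> permutations_of_set (new_blocks n m (X \<omega>))"
    using L by (auto simp: exchangeable_order_def)
  have meas: "E t \<in> events" for t
  proof -
    have "E t = ((\<lambda>\<omega>. restr (X \<omega>) (n + m)) -` {fst t} \<inter> space M) \<inter> (L -` {snd t} \<inter> space M)"
      by (auto simp: E_def split: prod.splits)
    then show ?thesis using measurable_sets[OF measurable_restr] measurable_sets[OF Lm] by auto
  qed
  have event: "{\<omega> \<in> space M. restr (X \<omega>) n = \<pi> \<and> map card (L \<omega>) = ns} = (\<Union>t\<in>T. E t)"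
  proof -
    have "partition_on {1..n + m} (restr (X \<omega>) (n + m))" if "\<omega> \<in> space M" for \<omega>
      using partition[OF that] by (rule partition_on_restr) auto
    then show ?thesis using Lp
      by (auto simp: E_def T_def restr_restr new_blocks_restr)
  qed
  \<comment> \<open>The ordering hypothesis is used with \<open>N = n + m\<close>; all orders of the
    new blocks are equally likely, whence the factorial of their number.\<close>
  have probE: "prob (E (P, l)) = V (n + m) (card P) * (\<Prod>B\<in>P. w B) / fact (length ns)"
    if "(P, l) \<in> T" for P l
  proof -
    have P: "partition_on {1..n + m} P" and l: "l \<in> permutations_of_set (new_blocks n m P)"
      and ns: "map card l = ns" using that by (auto simp: T_def)
    have "length ns = card (new_blocks n m P)"
      using l ns length_finite_permutations_of_set by fastforce
    moreover have "prob (E (P, l)) =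
        \<P>(\<omega> in M. restr (X \<omega>) (n + m) = P) / fact (card (new_blocks n m P))"
      using L P l unfolding exchangeable_order_def E_def by auto
    ultimately show ?thesis using gibbs_law[of "n + m" P] P n by (simp add: w_def)
  qed
  \<comment> \<open>The Gibbs product splits over old and new blocks because \<open>Q\<close> and
    \<open>set l\<close> share no block: one kind meets the ground set of \<pi>, the other does
    not.\<close>
  have pair: "prob (E (Q \<union> set l, l)) =
      V (n + m) (card \<pi> + length ns) / fact (length ns) * (\<Prod>x\<leftarrow>ns. pochhammer (1 - \<alpha>) (x - 1)) *
        (\<Prod>B\<in>Q. w B)"
    if l: "l \<in> block_lists U ns" and Q: "Q \<in> extensions \<pi> (U - \<Union>(set l))" for l Q
  proof -
    have "(Q \<union> set l, l) \<in> T"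
      using bij_betw_apply[OF bij, of "(l, Q)"] l Q by auto
    note prob = probE[OF this]
    have card: "map card l = ns" using l by (simp add: block_lists_def)
    have dist: "distinct l" using block_lists_partition[OF ns(1) l] by simp
    have UQ: "\<Union>Q = \<Union>\<pi> \<union> (U - \<Union>(set l))"
      using Q by (auto simp: extensions_def partition_on_def)
    have "\<Union>\<pi> \<inter> B = {}" if "B \<in> set l" for B
    proof -
      have "B \<subseteq> {n + 1..n + m}" using l that by (auto simp: U_def block_lists_def)
      then show ?thesis unfolding U\<pi> by fastforce
    qed
    moreover have "\<Union>\<pi> \<inter> B \<noteq> {}" if "B \<in> Q" for B
      using Q e\<pi> that by (auto simp: extensions_def)
    ultimately have "Q \<inter> set l = {}" by blast
    moreover have "finite Q" using UQ finU by (intro finite_UnionD) (simp add: U\<pi>)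
    moreover have "card Q = card \<pi>"
      using card_extensions[OF d\<pi> e\<pi> UR Q] .
    moreover have "card (set l) = length ns"
      using dist card by (metis distinct_card length_map)
    moreover have "(\<Prod>B\<in>set l. w B) = (\<Prod>x\<leftarrow>ns. pochhammer (1 - \<alpha>) (x - 1))"
      using dist by (simp add: prod.distinct_set_conv_list w_def card[symmetric] o_def)
    ultimately show ?thesis
      by (simp add: prob card_Un_disjoint prod.union_disjoint)
  qed
  have ext: "(\<Sum>Q\<in>extensions \<pi> (U - \<Union>(set l)). \<Prod>B\<in>Q. w B) =
      (\<Prod>A\<in>\<pi>. w A) * pochhammer (real n - real (card \<pi>) * \<alpha>) (m - sum_list ns)"
    if l: "l \<in> block_lists U ns" for l
  proof -
    have sub: "\<Union>(set l) \<subseteq> U" and card: "map card l = ns" using l by (auto simp: block_lists_def)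
    have "disjoint (set l)" "distinct l"
      using block_lists_partition[OF ns(1) l] by (auto simp: partition_on_def)
    then have "card (\<Union>(set l)) = sum_list ns"
      using card_Union_disjoint[of "set l"] sub finU card
      by (auto simp: sum.distinct_set_conv_list intro: finite_subset)
    then have "card (U - \<Union>(set l)) = m - sum_list ns"
      using sub finU cardU by (simp add: card_Diff_subset finite_subset)
    then show ?thesis
      using sum_extensions_prod_pochhammer[OF d\<pi> e\<pi> UR, of "\<Union>(set l)" \<alpha>] finU
      by (simp add: U\<pi> w_def)
  qed
  have "\<P>(\<omega> in M. restr (X \<omega>) n = \<pi> \<and> map card (L \<omega>) = ns) = (\<Sum>t\<in>T. prob (E t))"
    unfolding event
    by (rule finite_measure_finite_Union[OF finT])
      (use meas in \<open>auto simp: disjoint_family_on_def E_def\<close>)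
  also have "\<dots> = (\<Sum>(l, Q)\<in>(SIGMA l:block_lists U ns. extensions \<pi> (U - \<Union>(set l))).
      prob (E (Q \<union> set l, l)))"
    unfolding sum.reindex_bij_betw[OF bij, symmetric] by (simp add: case_prod_unfold)
  also have "\<dots> = (\<Sum>l\<in>block_lists U ns. \<Sum>Q\<in>extensions \<pi> (U - \<Union>(set l)). prob (E (Q \<union> set l, l)))"
    using finite_block_lists[OF finU] fin_ext by (subst sum.Sigma) auto
  also have "\<dots> = (\<Sum>l\<in>block_lists U ns.
      V (n + m) (card \<pi> + length ns) / fact (length ns) * (\<Prod>x\<leftarrow>ns. pochhammer (1 - \<alpha>) (x - 1)) *
        ((\<Prod>A\<in>\<pi>. w A) * pochhammer (real n - real (card \<pi>) * \<alpha>) (m - sum_list ns)))"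
    by (intro sum.cong refl) (simp only: pair ext sum_distrib_left[symmetric] cong: sum.cong)
  \<comment> \<open>The summand is now constant in \<open>l\<close>.\<close>
  also have "\<dots> = fact m / ((\<Prod>x\<leftarrow>ns. fact x) * fact (m - sum_list ns)) *
      (V (n + m) (card \<pi> + length ns) / fact (length ns) * (\<Prod>x\<leftarrow>ns. pochhammer (1 - \<alpha>) (x - 1)) *
        ((\<Prod>A\<in>\<pi>. w A) * pochhammer (real n - real (card \<pi>) * \<alpha>) (m - sum_list ns)))"
    using card_block_lists[OF finU, of ns] ns(2) by (simp add: cardU)
  also have "\<dots> = (\<Prod>A\<in>\<pi>. w A) *
    (V (n + m) (card \<pi> + length ns) / fact (length ns)) *
    (fact m * (\<Prod>x\<leftarrow>ns. pochhammer (1 - \<alpha>) (x - 1) / fact x)) *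
    (pochhammer (real n - real (card \<pi>) * \<alpha>) (m - sum_list ns) / fact (m - sum_list ns))"
  proof -
    have "(\<Prod>x\<leftarrow>ns. pochhammer (1 - \<alpha>) (x - 1) / fact x) =
        (\<Prod>x\<leftarrow>ns. pochhammer (1 - \<alpha>) (x - 1)) / (\<Prod>x\<leftarrow>ns. fact x)"
      by (induction ns) simp_all
    then show ?thesis by (simp add: ac_simps)
  qed
  finally show ?thesis by (simp add: w_def)
qed

end

section \<open>Law of the first sizes and the number of new blocks\<close>

text \<open>These bounds show that the full list of sizes meets the hypotheses on \<open>ns\<close>
  in \<open>prob_new_sizes\<close>, so that the possible size lists form a finite family of
  compositions.\<close>

lemma card_new_blocks_order:
  assumes P: "partition_on {1..n + m} P" and l: "l \<in> permutations_of_set (new_blocks n m P)"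
  shows "x \<in> set (map card l) \<Longrightarrow> 1 \<le> x" and "sum_list (map card l) \<le> m"
proof -
  have setl: "set l = {B \<in> P. B \<inter> {1..n} = {}}" and "distinct l"
    using l by (auto simp: permutations_of_set_def new_blocks_eq[OF P])
  have fin: "finite B" if "B \<in> P" for B
    using P that finite_subset[of B "{1..n + m}"] by (auto simp: partition_on_def)
  show "1 \<le> x" if "x \<in> set (map card l)"
  proof -
    obtain B where B: "x = card B" "B \<in> set l" using \<open>x \<in> set (map card l)\<close> by auto
    then have "B \<in> P" "B \<noteq> {}" using setl P by (auto simp: partition_on_def)
    then show ?thesis using fin B by (simp add: Suc_le_eq card_gt_0_iff)
  qed
  have "disjoint (set l)"
    using P setl by (auto simp: partition_on_def pairwise_def)
  then have "card (\<Union>(set l)) = sum_list (map card l)"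
    using card_Union_disjoint[of "set l"] fin setl
      sum.distinct_set_conv_list[OF \<open>distinct l\<close>, of card] by auto
  moreover have "\<Union>(set l) \<subseteq> {n + 1..n + m}"
  proof
    fix x assume "x \<in> \<Union>(set l)"
    then have "x \<in> {1..n + m}" "x \<notin> {1..n}"
      using setl P unfolding partition_on_def by blast+
    then show "x \<in> {n + 1..n + m}" by auto
  qed
  then have "card (\<Union>(set l)) \<le> card {n + 1..n + m}" by (intro card_mono) auto
  ultimately show "sum_list (map card l) \<le> m" by simp
qed

text \<open>This turns sizes indexed from 1 into a prefix condition. The bound on \<open>r\<close>
  keeps every access inside the list, where \<open>nth\<close> is specified.\<close>

lemma map_nth_eq_iff:
  assumes "r \<le> length l"
  shows "(\<forall>i\<in>{1..r}. f (l ! (i - 1)) = s i) \<longleftrightarrow> take r (map f l) = map s [1..<Suc r]"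
proof -
  have "take r (map f l) = map s [1..<Suc r] \<longleftrightarrow> (\<forall>i<r. f (l ! i) = s (Suc i))"
    using assms by (auto simp: list_eq_iff_nth_eq simp del: upt_Suc)
  also have "\<dots> \<longleftrightarrow> (\<forall>i\<in>{1..r}. f (l ! (i - 1)) = s i)"
  proof
    assume *: "\<forall>i<r. f (l ! i) = s (Suc i)"
    show "\<forall>i\<in>{1..r}. f (l ! (i - 1)) = s i"
    proof
      fix i assume "i \<in> {1..r}"
      then have "i - 1 < r" "Suc (i - 1) = i" by auto
      then show "f (l ! (i - 1)) = s i" using * by metis
    qed
  next
    assume *: "\<forall>i\<in>{1..r}. f (l ! (i - 1)) = s i"
    show "\<forall>i<r. f (l ! i) = s (Suc i)"
    proof (intro allI impI)
      fix i assume "i < r"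
      then show "f (l ! i) = s (Suc i)" using *[rule_format, of "Suc i"] by simp
    qed
  qed
  finally show ?thesis ..
qed

lemma length_le_sum_list: "\<forall>x\<in>set ns. 1 \<le> x \<Longrightarrow> length ns \<le> sum_list (ns :: nat list)"
  by (induction ns) auto

theorem proposition6:
  fixes M :: "'a measure" and \<alpha> :: real and V :: "nat \<Rightarrow> nat \<Rightarrow> real"
    and X :: "'a \<Rightarrow> nat set set" and L :: "'a \<Rightarrow> nat set list"
    and n m j r k :: nat and \<pi> :: "nat set set" and s :: "nat \<Rightarrow> nat"
  assumes "gibbs_partition M \<alpha> V X"
    and "1 \<le> n" and "1 \<le> m"
    and "partition_on {1..n} \<pi>" and "card \<pi> = j" and "V n j > 0"
    and "exchangeable_order M X n m L"
    and "1 \<le> r" and "\<And>i. i \<in> {1..r} \<Longrightarrow> 1 \<le> s i"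
    and "(\<Sum>i=1..r. s i) \<le> m"
    and "r \<le> k" and "k - r \<le> m - (\<Sum>i=1..r. s i)"
  shows "\<P>(\<omega> in M. (\<forall>i\<in>{1..r}. new_size L i \<omega> = s i) \<and> num_new X n m \<omega> = k
            \<bar> restr (X \<omega>) n = \<pi>) =
         fact m * (\<Prod>i=1..r. pochhammer (1 - \<alpha>) (s i - 1))
           / ((\<Prod>i=1..r. fact (s i)) * fact (m - (\<Sum>i=1..r. s i)))
         * (fact (k - r) / fact k)
         * (V (n + m) (j + k) / V n j)
         * noncentral_stirling \<alpha> (- (real n - real j * \<alpha>)) (m - (\<Sum>i=1..r. s i)) (k - r)"
proof -
  interpret gibbs_partition M \<alpha> V X by fact
  note n = assms(2) and \<pi> = assms(4) and j = assms(5) and L = assms(7)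
  define ss where "ss = map s [1..<Suc r]"
  define m' where "m' = m - (\<Sum>i=1..r. s i)"
  define W where "W = (\<Prod>A\<in>\<pi>. pochhammer (1 - \<alpha>) (card A - 1))"
  define w where "w = (\<lambda>x::nat. pochhammer (1 - \<alpha>) (x - 1) / fact x)"
  \<comment> \<open>With \<open>t\<close> elements in the new blocks after the first
    \<open>r\<close>, the other \<open>m' - t\<close> elements join old blocks; this is their
    contribution.\<close>
  define poch where "poch = (\<lambda>t. pochhammer (real n - real j * \<alpha>) (m' - t) / fact (m' - t))"
  define F where "F = (\<lambda>ns. {\<omega> \<in> space M. restr (X \<omega>) n = \<pi> \<and> map card (L \<omega>) = ns})"
  \<comment> \<open>These are the possible sizes of the remaining \<open>k - r\<close> new blocks,
    of total \<open>t\<close>. Each size is at least 1, so \<open>t\<close> starts at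
    \<open>k - r\<close>.\<close>
  define C where "C = (\<Union>t\<in>{k - r..m'}. compositions t (k - r))"

  have W_pos: "0 < W"
    unfolding W_def using alpha_less_1 by (intro prod_pos pochhammer_pos) auto
  have ss: "length ss = r" "sum_list ss = (\<Sum>i=1..r. s i)" "\<And>x. x \<in> set ss \<Longrightarrow> 1 \<le> x"
    using assms(9)
    by (auto simp: ss_def sum_list_distinct_conv_sum_set atLeastLessThanSuc_atLeastAtMost simp del: upt_Suc)
  have prod_ss: "(\<Prod>x\<leftarrow>ss. w x) = (\<Prod>i=1..r. pochhammer (1 - \<alpha>) (s i - 1)) / (\<Prod>i=1..r. fact (s i))"
    by (simp add: ss_def w_def o_def prod.distinct_set_conv_list[symmetric] prod_dividef
        atLeastLessThanSuc_atLeastAtMost del: upt_Suc One_nat_def)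

  have sizes: "((\<forall>i\<in>{1..r}. new_size L i \<omega> = s i) \<and> num_new X n m \<omega> = k) \<longleftrightarrow>
      map card (L \<omega>) \<in> (@) ss ` C" if \<omega>: "\<omega> \<in> space M" for \<omega>
  proof -
    have P: "partition_on {1..n + m} (restr (X \<omega>) (n + m))"
      using partition[OF \<omega>] by (rule partition_on_restr) auto
    have perm: "L \<omega> \<in> permutations_of_set (new_blocks n m (X \<omega>))"
      using L \<omega> by (simp add: exchangeable_order_def)
    note sz = card_new_blocks_order[OF P, unfolded new_blocks_restr, OF perm]
    have len: "length (L \<omega>) = num_new X n m \<omega>"
      using perm by (simp add: num_new_def length_finite_permutations_of_set)
    show ?thesis
    proof
      assume A: "(\<forall>i\<in>{1..r}. new_size L i \<omega> = s i) \<and> num_new X n m \<omega> = k"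
      define ns where "ns = drop r (map card (L \<omega>))"
      \<comment> \<open>The list has length \<open>k\<close>, which is at least \<open>r\<close>, so
        the first \<open>r\<close> sizes are genuine entries.\<close>
      have "take r (map card (L \<omega>)) = ss"
        using A map_nth_eq_iff[of r "L \<omega>" card s] len assms(11) by (simp add: new_size_def ss_def)
      then have eq: "map card (L \<omega>) = ss @ ns" unfolding ns_def by (metis append_take_drop_id)
      have "length ns = k - r" using A len by (simp add: ns_def)
      moreover have pos: "\<forall>x\<in>set ns. 1 \<le> x" using sz(1) unfolding eq by auto
      moreover have "sum_list ns \<le> m'" using sz(2) ss(2) unfolding eq by (simp add: m'_def)
      ultimately have "ns \<in> C"
        using length_le_sum_list[OF pos] by (auto simp: C_def compositions_def)
      then show "map card (L \<omega>) \<in> (@) ss ` C" using eq by simp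
    next
      assume "map card (L \<omega>) \<in> (@) ss ` C"
      then obtain ns where ns: "map card (L \<omega>) = ss @ ns" "length ns = k - r"
        by (auto simp: C_def compositions_def)
      then have "length (L \<omega>) = k" using ss(1) assms(11)
        by (metis length_append length_map le_add_diff_inverse)
      moreover have "take r (map card (L \<omega>)) = ss" using ns ss(1) by simp
      ultimately show "(\<forall>i\<in>{1..r}. new_size L i \<omega> = s i) \<and> num_new X n m \<omega> = k"
        using map_nth_eq_iff[of r "L \<omega>" card s] len assms(11) by (simp add: new_size_def ss_def)
    qed
  qed
  have finC: "finite C" by (simp add: C_def finite_compositions)
  have meas: "F ns \<in> events" for ns
  proof -
    have Lm: "L \<in> M \<rightarrow>\<^sub>M count_space UNIV" using L by (simp add: exchangeable_order_def)
    have "F ns = ((\<lambda>\<omega>. restr (X \<omega>) n) -` {\<pi>} \<inter> space M) \<inter> (L -` {l. map card l = ns} \<inter> space M)"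
      by (auto simp: F_def)
    then show ?thesis
      using measurable_sets[OF measurable_restr, of "{\<pi>}"]
        measurable_sets[OF Lm, of "{l. map card l = ns}"] by (simp only: sets.Int sets_count_space Pow_UNIV UNIV_I)
  qed
  have prob_F: "prob (F (ss @ ns)) =
      W * (V (n + m) (j + k) / fact k) * (fact m * (\<Prod>x\<leftarrow>ss. w x)) * (poch t * (\<Prod>x\<leftarrow>ns. w x))"
    if "t \<le> m'" "ns \<in> compositions t (k - r)" for t ns
  proof -
    have sum: "sum_list (ss @ ns) = (\<Sum>i=1..r. s i) + t" and len: "length (ss @ ns) = k"
      using that ss assms(11) by (auto simp: compositions_def)
    have pos: "1 \<le> x" if "x \<in> set (ss @ ns)" for x
      using that ss(3) \<open>ns \<in> _\<close> by (auto simp: compositions_def)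
    have le: "sum_list (ss @ ns) \<le> m" using sum that(1) assms(10) by (simp add: m'_def)
    have "m - sum_list (ss @ ns) = m' - t" using sum by (simp add: m'_def)
    then show ?thesis
      using prob_new_sizes[OF L n \<pi> pos le] len
      by (simp add: F_def W_def w_def poch_def j)
  qed
  have "{\<omega> \<in> space M. ((\<forall>i\<in>{1..r}. new_size L i \<omega> = s i) \<and> num_new X n m \<omega> = k) \<and> restr (X \<omega>) n = \<pi>} =
      {\<omega> \<in> space M. map card (L \<omega>) \<in> (@) ss ` C \<and> restr (X \<omega>) n = \<pi>}"
    by (intro Collect_cong conj_cong refl sizes)
  also have "\<dots> = (\<Union>ns\<in>C. F (ss @ ns))" by (auto simp: F_def)
  finally have "\<P>(\<omega> in M. ((\<forall>i\<in>{1..r}. new_size L i \<omega> = s i) \<and> num_new X n m \<omega> = k) \<and> restr (X \<omega>) n = \<pi>) =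
      prob (\<Union>ns\<in>C. F (ss @ ns))" by simp
  also have "\<dots> = (\<Sum>ns\<in>C. prob (F (ss @ ns)))"
    by (rule finite_measure_finite_Union[OF finC])
      (use meas in \<open>auto simp: disjoint_family_on_def F_def\<close>)
  \<comment> \<open>Compositions with different totals are distinct, so the union defining
    \<open>C\<close> is disjoint.\<close>
  also have "\<dots> = (\<Sum>t=k - r..m'. \<Sum>ns\<in>compositions t (k - r). prob (F (ss @ ns)))"
    unfolding C_def by (rule sum.UNION_disjoint) (auto simp: finite_compositions, auto simp: compositions_def)
  also have "\<dots> = (\<Sum>t=k - r..m'. W * (V (n + m) (j + k) / fact k) * (fact m * (\<Prod>x\<leftarrow>ss. w x)) *
      (poch t * (\<Sum>ns\<in>compositions t (k - r). \<Prod>x\<leftarrow>ns. w x)))"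
    unfolding sum_distrib_left by (intro sum.cong refl prob_F) auto
  \<comment> \<open>The sum over compositions is a central Stirling number times
    \<open>fact (k - r) / fact t\<close>. Together with \<open>1 / fact (m' - t)\<close> from
    \<open>poch\<close>, the factor \<open>1 / fact t\<close> forms the binomial coefficient divided
    by \<open>fact m'\<close>.\<close>
  also have "\<dots> = (\<Sum>t=k - r..m'. W * (V (n + m) (j + k) / fact k) * (fact m * (\<Prod>x\<leftarrow>ss. w x)) *
      (fact (k - r) / fact m' *
        (real (m' choose t) * central_stirling \<alpha> t (k - r) * pochhammer (real n - real j * \<alpha>) (m' - t))))"
  proof (rule sum.cong[OF refl], rule arg_cong2[where f = "(*)", OF refl])
    fix t assume "t \<in> {k - r..m'}"
    then show "poch t * (\<Sum>ns\<in>compositions t (k - r). \<Prod>x\<leftarrow>ns. w x) = fact (k - r) / fact m' *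
        (real (m' choose t) * central_stirling \<alpha> t (k - r) * pochhammer (real n - real j * \<alpha>) (m' - t))"
      by (simp add: binomial_fact central_stirling_def poch_def w_def)
  qed
  also have "\<dots> = W * (V (n + m) (j + k) / fact k) * (fact m * (\<Prod>x\<leftarrow>ss. w x)) *
      (fact (k - r) / fact m' * noncentral_stirling \<alpha> (- (real n - real j * \<alpha>)) m' (k - r))"
    by (simp only: noncentral_stirling_def sum_distrib_left[symmetric] minus_minus)
  finally have num: "\<P>(\<omega> in M. ((\<forall>i\<in>{1..r}. new_size L i \<omega> = s i) \<and> num_new X n m \<omega> = k) \<and>
      restr (X \<omega>) n = \<pi>) = \<dots>" .
  \<comment> \<open>On division by the probability of the conditioning event, the positive factor
    \<open>W\<close> of the old blocks cancels and \<open>V n j\<close> remains.\<close>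
  have "\<P>(\<omega> in M. restr (X \<omega>) n = \<pi>) = V n j * W"
    using gibbs_law[OF n \<pi>] by (simp add: W_def j)
  then show ?thesis
    using W_pos assms(6) unfolding cond_prob_def num prod_ss m'_def[symmetric]
    by (simp add: ac_simps)
qed

end
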